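(* Let $A \in M_n(\mathbb{C})$. Then the multi-valued map $f_A^{-1}\colon F(A) \to \mathbb{C}\mathbb{P}^{n-1}$ is strongly continuous at every point $z \in F(A)$ that is not a round point of the boundary $\partial F(A)$.
   Context: For $A \in M_n(\mathbb{C})$ the field of values is $F(A) = \{x^*Ax : x \in \mathbb{C}^n,\ x^*x = 1\} \subset \mathbb{C}$ (a compact convex set). Let $\mathbb{C}\mathbb{P}^{n-1}$ be the quotient of the unit sphere $\{x \in \mathbb{C}^n : x^*x=1\}$ by multiplication by unimodular scalars, with a metric inducing the quotient topology. Since $(\omega x)^*A(\omega x) = x^*Ax$ for $|\omega|=1$, the map $f_A(x) = x^*Ax$ (with $x$ a unit representative) is a well-defined map $\mathbb{C}\mathbb{P}^{n-1} \to F(A)$, and $f_A^{-1}$ is the multi-valued map sending $z \in F(A)$ to its preimage $f_A^{-1}(z) = \{x \in \mathbb{C}\mathbb{P}^{n-1} : f_A(x) = z\}$. A multi-valued function $g$ from a metric space $(X,d)$ to a metric space $(Y,\rho)$ is strongly continuous at $x \in X$ if for all $y \in g(x)$: for every $\epsilon>0$ there is $\delta>0$ such that for every $x' \in X$ with $d(x,x')<\delta$ there exists $y' \in g(x')$ with $\rho(y,y')<\epsilon$. Here $X = F(A)$ with the usual metric of $\mathbb{C}$. Round points: a point $z \in \partial F(A)$ is not a round point of $\partial F(A)$ if and only if both one-sided neighborhoods of $z$ in $\partial F(A)$ are line segments when the radius of the neighborhood is sufficiently small (i.e., each of the two arcs of $\partial F(A)$ emanating from $z$ is a line segment near $z$).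 In particular, if $F(A)$ is a convex polygon (including the degenerate cases of a line segment or a single point), $\partial F(A)$ has no round points. *)

theory Defs
  imports "HOL-Analysis.Analysis"
begin

definition hinner :: "complex ^ 'n \<Rightarrow> complex ^ 'n \<Rightarrow> complex" where
  "hinner x y = (\<Sum>i\<in>UNIV. cnj (x $ i) * y $ i)"

definition unit_sphere :: "(complex ^ 'n) set" where
  "unit_sphere = {x. hinner x x = 1}"

lemma hinner_self: "hinner x x = complex_of_real ((norm x)\<^sup>2)"
proof -
  have "(norm x)\<^sup>2 = (\<Sum>i\<in>UNIV. (cmod (x $ i))\<^sup>2)"
    by (simp add: norm_vec_def L2_set_def sum_nonneg)
  then show ?thesis
    by (simp only: hinner_def of_real_sum complex_norm_square mult.commute)
qed

lemma unit_sphere_eq_sphere: "unit_sphere = (sphere 0 1 :: (complex ^ 'n) set)"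
proof -
  have "(norm x)\<^sup>2 = 1 \<longleftrightarrow> norm x = 1" for x :: "complex ^ 'n"
    using norm_ge_zero[of x] unfolding power2_eq_1_iff by linarith
  then show ?thesis
    by (simp add: unit_sphere_def hinner_self sphere_def dist_norm del: of_real_power)
qed

definition field_of_values :: "complex ^ 'n ^ 'n \<Rightarrow> complex set" where
  "field_of_values A = {hinner x (A *v x) | x. x \<in> unit_sphere}"

definition phase_rel :: "((complex ^ 'n) \<times> (complex ^ 'n)) set" where
  "phase_rel = {(x, y). x \<in> unit_sphere \<and> y \<in> unit_sphere \<and> (\<exists>w. cmod w = 1 \<and> y = w *s x)}"

definition cproj_space :: "(complex ^ 'n) set set" where
  "cproj_space = unit_sphere // phase_rel"

definition cproj :: "complex ^ 'n \<Rightarrow> (complex ^ 'n) set" where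
  "cproj x = phase_rel `` {x}"

text \<open>No metric on the projective space is singled out: \<open>quotient_metric\<close> holds of every metric that
  induces the quotient topology. One exists, see \<open>quotient_metric_exists\<close> below.\<close>

definition quotient_metric :: "((complex ^ 'n) set \<Rightarrow> (complex ^ 'n) set \<Rightarrow> real) \<Rightarrow> bool" where
  "quotient_metric \<rho> \<longleftrightarrow> Metric_space cproj_space \<rho> \<and>
     quotient_map (top_of_set unit_sphere) (Metric_space.mtopology cproj_space \<rho>) cproj"

text \<open>\<^const>\<open>the_elem\<close> extracts the common value of \<open>x\<^sup>* A x\<close> on the representatives.\<close>

definition fov_map :: "complex ^ 'n ^ 'n \<Rightarrow> (complex ^ 'n) set \<Rightarrow> complex" where
  "fov_map A p = the_elem ((\<lambda>x. hinner x (A *v x)) ` p)"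

definition fov_inverse :: "complex ^ 'n ^ 'n \<Rightarrow> complex \<Rightarrow> (complex ^ 'n) set set" where
  "fov_inverse A z = {p \<in> cproj_space. fov_map A p = z}"

lemma hinner_scale: "hinner (w *s x) (v *s y) = cnj w * v * hinner x y"
  by (simp add: hinner_def sum_distrib_left mult_ac)

lemma cnj_mult_unit: "cmod w = 1 \<Longrightarrow> cnj w * w = 1"
  using complex_norm_square[of w] by (simp add: mult.commute)

lemma equiv_phase_rel: "equiv unit_sphere (phase_rel :: ((complex ^ 'n) \<times> (complex ^ 'n)) set)"
  (is "equiv ?S ?R")
proof (rule equivI)
  show "?R \<subseteq> ?S \<times> ?S" by (auto simp: phase_rel_def)
  have "(x, x) \<in> phase_rel" if "x \<in> unit_sphere" for x :: "complex ^ 'n"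
    using that unfolding phase_rel_def by (simp, intro exI[of _ 1], simp)
  then show "refl_on ?S ?R" by (simp add: refl_on_def)
  show "sym ?R"
  proof (rule symI)
    fix x y :: "complex ^ 'n" assume "(x, y) \<in> phase_rel"
    then obtain w where w: "x \<in> unit_sphere" "y \<in> unit_sphere" "cmod w = 1" "y = w *s x"
      by (auto simp: phase_rel_def)
    then have "x = cnj w *s y" by (simp add: vector_smult_assoc cnj_mult_unit)
    moreover have "cmod (cnj w) = 1" using w by simp
    ultimately show "(y, x) \<in> phase_rel" using w(1,2) unfolding phase_rel_def by blast
  qed
  show "trans ?R"
  proof (rule transI)
    fix x y z :: "complex ^ 'n" assume "(x, y) \<in> phase_rel" "(y, z) \<in> phase_rel"
    then obtain v w where *: "x \<in> unit_sphere" "z \<in> unit_sphere" "cmod w = 1" "cmod v = 1"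
      "y = v *s x" "z = w *s y"
      unfolding phase_rel_def by blast
    then have "z = (w * v) *s x" by (simp only: vector_smult_assoc)
    moreover have "cmod (w * v) = 1" using * by (simp add: norm_mult)
    ultimately show "(x, z) \<in> phase_rel" using *(1,2) unfolding phase_rel_def by blast
  qed
qed

lemma fov_map_cproj:
  assumes "x \<in> unit_sphere"
  shows "fov_map A (cproj x) = hinner x (A *v x)"
proof -
  have "x \<in> cproj x"
    using equiv_class_self[OF equiv_phase_rel assms] by (simp add: cproj_def)
  then have "cproj x \<noteq> {}" by blast
  moreover have "hinner y (A *v y) = hinner x (A *v x)" if "y \<in> cproj x" for y
    using that by (auto simp: cproj_def phase_rel_def vector_scalar_commute hinner_scale cnj_mult_unit)
  ultimately show ?thesis
    unfolding fov_map_def by (rule the_elem_image_unique)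
qed

lemma quotient_metric_exists: "\<exists>\<rho>. quotient_metric (\<rho> :: (complex ^ 'n) set \<Rightarrow> _)"
proof -
  define h :: "complex ^ 'n \<Rightarrow> complex ^ 'n ^ 'n" where "h x = (\<chi> i j. x $ i * cnj (x $ j))" for x
  define H where "H p = the_elem (h ` p)" for p
  define \<rho> where "\<rho> p q = dist (H p) (H q)" for p q
  have h_scale: "h (w *s x) = h x" if "cmod w = 1" for w x
  proof -
    have "(w *s x) $ i * cnj ((w *s x) $ j) = (cnj w * w) * (x $ i * cnj (x $ j))" for i j
      by (simp add: mult_ac)
    then have "(w *s x) $ i * cnj ((w *s x) $ j) = x $ i * cnj (x $ j)" for i j
      using that by (simp only: cnj_mult_unit mult_1_left)
    then show ?thesis by (simp only: h_def)
  qed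
  have H: "H (cproj x) = h x" if "x \<in> unit_sphere" for x
    unfolding H_def
  proof (rule the_elem_image_unique)
    show "cproj x \<noteq> {}"
      using equiv_class_self[OF equiv_phase_rel that] by (auto simp: cproj_def)
    show "h y = h x" if "y \<in> cproj x" for y
      using that by (auto simp: cproj_def phase_rel_def h_scale)
  qed
  have inj: "cproj x = cproj y" if xy: "x \<in> unit_sphere" "y \<in> unit_sphere" "h x = h y" for x y
  proof -
    define w where "w = hinner x y"
    have comp: "y $ i * cnj (y $ j) = x $ i * cnj (x $ j)" for i j
      using xy(3) by (simp add: h_def vec_eq_iff)
    have "y $ i = w * x $ i" for i
    proof -
      have "y $ i = y $ i * hinner y y" using xy by (simp add: unit_sphere_def)
      also have "\<dots> = (\<Sum>j\<in>UNIV. (y $ i * cnj (y $ j)) * y $ j)"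
        by (simp add: hinner_def sum_distrib_left mult.assoc)
      also have "\<dots> = (\<Sum>j\<in>UNIV. (x $ i * cnj (x $ j)) * y $ j)" by (simp only: comp)
      also have "\<dots> = w * x $ i"
        by (simp add: w_def hinner_def sum_distrib_left sum_distrib_right mult_ac)
      finally show ?thesis .
    qed
    then have y: "y = w *s x" by (simp add: vec_eq_iff)
    have "cnj w * w = 1"
      using xy(1,2) hinner_scale[of w x w x] by (simp add: unit_sphere_def y)
    then have "complex_of_real ((cmod w)\<^sup>2) = complex_of_real 1"
      by (simp only: complex_norm_square mult.commute of_real_1)
    then have "(cmod w)\<^sup>2 = 1" by (simp only: of_real_eq_iff)
    then have "cmod w = 1" using norm_ge_zero[of w] unfolding power2_eq_1_iff by linarith
    with y xy have "(x, y) \<in> phase_rel" unfolding phase_rel_def by blast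
    then show ?thesis
      unfolding cproj_def by (rule equiv_class_eq[OF equiv_phase_rel])
  qed
  have space: "cproj_space = cproj ` (unit_sphere :: (complex ^ 'n) set)"
    by (auto simp: cproj_space_def quotient_def cproj_def)
  interpret M: Metric_space cproj_space \<rho>
  proof
    show "(\<rho> p q = 0) = (p = q)" if pq: "p \<in> cproj_space" "q \<in> cproj_space" for p q
    proof -
      obtain x y where "x \<in> unit_sphere" "p = cproj x" "y \<in> unit_sphere" "q = cproj y"
        using pq unfolding space by blast
      then show ?thesis using inj[of x y] by (metis H \<rho>_def dist_eq_0_iff)
    qed
    show "\<rho> p r \<le> \<rho> p q + \<rho> q r" for p q r
      unfolding \<rho>_def by (rule dist_triangle)
  qed (simp_all only: \<rho>_def dist_commute zero_le_dist)
  have cont: "continuous_on unit_sphere h"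
    unfolding h_def by (intro continuous_intros)
  have "continuous_map (top_of_set unit_sphere) M.mtopology cproj"
    unfolding M.continuous_map_to_metric
  proof (intro ballI allI impI)
    fix x :: "complex ^ 'n" and e :: real
    assume "x \<in> topspace (top_of_set unit_sphere)" "e > 0"
    then have x: "x \<in> unit_sphere" by simp
    have "openin (top_of_set unit_sphere) (unit_sphere \<inter> h -` ball (h x) e)"
      by (rule continuous_openin_preimage_gen[OF cont open_ball])
    moreover have "cproj y \<in> M.mball (cproj x) e" if "y \<in> unit_sphere \<inter> h -` ball (h x) e" for y
    proof -
      have "cproj x \<in> cproj_space" "cproj y \<in> cproj_space" "\<rho> (cproj x) (cproj y) < e"
        using that x by (auto simp: space \<rho>_def H)
      then show ?thesis by (simp only: M.in_mball simp_thms)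
    qed
    ultimately show "\<exists>U. openin (top_of_set unit_sphere) U \<and> x \<in> U \<and>
        (\<forall>y\<in>U. cproj y \<in> M.mball (cproj x) e)"
      using x \<open>e > 0\<close> by (meson IntI centre_in_ball vimageI)
  qed
  moreover have "compact_space (top_of_set (unit_sphere :: (complex ^ 'n) set))"
    by (simp add: unit_sphere_eq_sphere compact_space_subtopology)
  ultimately have "quotient_map (top_of_set unit_sphere) M.mtopology cproj"
    by (rule T1_Spaces.continuous_imp_quotient_map)
      (simp_all add: M.Hausdorff_space_mtopology flip: space)
  then show ?thesis
    unfolding quotient_metric_def using M.Metric_space_axioms by blast
qed

definition strongly_continuous_at ::
  "'a set \<Rightarrow> ('a \<Rightarrow> 'a \<Rightarrow> real) \<Rightarrow> ('b \<Rightarrow> 'b \<Rightarrow> real) \<Rightarrow> ('a \<Rightarrow> 'b set) \<Rightarrow> 'a \<Rightarrow> bool" where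
  "strongly_continuous_at X d \<rho> g x \<longleftrightarrow>
     (\<forall>y \<in> g x. \<forall>\<epsilon>>0. \<exists>\<delta>>0. \<forall>x' \<in> X. d x x' < \<delta> \<longrightarrow> (\<exists>y' \<in> g x'. \<rho> y y' < \<epsilon>))"

text \<open>For the boundary \<open>\<Gamma>\<close> of a two-dimensional compact convex set and small \<open>r\<close>, the punctured
  neighbourhood of \<open>z\<close> has exactly two components, one for each arc of \<open>\<Gamma>\<close> emanating from \<open>z\<close>. When
  \<open>\<Gamma>\<close> is a segment there are one or two of them, and when it is a single point there are none, so no
  point is round in these cases.\<close>

definition one_sided_nbhds :: "complex set \<Rightarrow> complex \<Rightarrow> real \<Rightarrow> complex set set" where
  "one_sided_nbhds \<Gamma> z r = insert z ` components (\<Gamma> \<inter> cball z r - {z})"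

definition round_point :: "complex set \<Rightarrow> complex \<Rightarrow> bool" where
  "round_point \<Gamma> z \<longleftrightarrow> z \<in> \<Gamma> \<and>
     \<not> (\<exists>r0>0. \<forall>r. 0 < r \<and> r < r0 \<longrightarrow> (\<forall>N \<in> one_sided_nbhds \<Gamma> z r. \<exists>p. N = closed_segment z p))"

end

theory Submission
  imports Defs
begin

text \<open>Let \<open>x\<close>, \<open>y\<close> be unit vectors and \<open>0 \<le> s < 1\<close>. In the span of \<open>x\<close> and \<open>y\<close> the map \<open>f\<^sub>A\<close> is the
  restriction to the Bloch sphere of an affine map from the Bloch ball to the plane. Moving from
  \<open>(1 - s) x + s y\<close> along a fibre of this map, in the direction that does not lead away from \<open>x\<close>,
  until the sphere is reached gives a unit vector at distance at most \<open>\<surd>(2 s)\<close> from \<open>x\<close>. So \<open>F(A)\<close> is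
  convex, and the image of the \<open>\<surd>(2 s)\<close>-neighbourhood of \<open>x\<close> contains \<open>z + s (F(A) - z)\<close> for
  \<open>z = f\<^sub>A(x)\<close>. It remains to see that for each \<open>s\<close> the set \<open>z + s (F(A) - z)\<close> contains a
  neighbourhood of \<open>z\<close> in \<open>F(A)\<close>; it does when \<open>F(A)\<close> coincides with a cone near \<open>z\<close>, which is what
  fails at round points.\<close>

section \<open>Algebra of the Hermitian form\<close>

lemma hinner_add_left: "hinner (x + y) u = hinner x u + hinner y u"
  by (simp add: hinner_def sum.distrib algebra_simps)

lemma hinner_add_right: "hinner u (x + y) = hinner u x + hinner u y"
  by (simp add: hinner_def sum.distrib algebra_simps)

lemma hinner_scale_left: "hinner (c *s x) y = cnj c * hinner x y"
  by (simp add: hinner_def sum_distrib_left mult_ac)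

lemma hinner_scale_right: "hinner x (c *s y) = c * hinner x y"
  by (simp add: hinner_def sum_distrib_left mult_ac)

lemma hinner_commute: "hinner y x = cnj (hinner x y)"
  by (simp add: hinner_def mult.commute)

lemma hinner_quadratic_form:
  "hinner (c *s x + d *s v) (A *v (c *s x + d *s v)) =
     cnj c * c * hinner x (A *v x) + cnj c * d * hinner x (A *v v)
     + cnj d * c * hinner v (A *v x) + cnj d * d * hinner v (A *v v)"
  by (simp add: matrix_vector_right_distrib vector_scalar_commute hinner_add_left hinner_add_right
      hinner_scale_left hinner_scale_right algebra_simps)

section \<open>The field of values on the span of two unit vectors\<close>

lemma cnj_mult_self: "cnj w * w = complex_of_real ((cmod w)\<^sup>2)"
  by (metis complex_norm_square mult.commute)

text \<open>The pairs \<open>(\<tau>, p)\<close> with \<open>\<bar>p\<bar>\<^sup>2 \<le> \<tau> (1 - \<tau>)\<close> parametrise the Bloch ball of a qubit, those with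
  equality its boundary sphere. The right-hand side is the value of an affine map to the plane at a
  convex combination of two points of the sphere; we move along a line on which the map is constant
  until the sphere is hit, in the direction that does not increase \<open>\<tau>\<close>.\<close>

lemma bloch_sphere_point:
  fixes \<alpha> P Q a :: complex and b s :: real
  assumes ab: "(cmod a)\<^sup>2 + b\<^sup>2 = 1" and s: "0 \<le> s" "s \<le> 1"
  obtains \<tau> p where "0 \<le> \<tau>" "\<tau> \<le> s" "(cmod p)\<^sup>2 = \<tau> * (1 - \<tau>)"
    "of_real \<tau> * \<alpha> + p * P + cnj p * Q = of_real s * (of_real (b\<^sup>2) * \<alpha> + cnj a * b * P + a * b * Q)"
proof -
  \<comment> \<open>For y = a x + b v with x, v orthonormal, the Bloch coordinates of x are (0, 0)
    and those of y are (\<open>b\<^sup>2\<close>, \<open>cnj a * b\<close>). The pair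
    (\<open>\<tau>0\<close>, \<open>p0\<close>) is their combination with weight \<open>s\<close> at
    y.\<close>
  define \<tau>0 where "\<tau>0 = s * b\<^sup>2"
  define p0 where "p0 = of_real s * cnj a * of_real b"
  have b1: "b\<^sup>2 \<le> 1" "0 \<le> b\<^sup>2" using ab by (smt (verit) zero_le_power2)+
  have \<tau>0: "0 \<le> \<tau>0" "\<tau>0 \<le> s" using s b1 by (simp_all add: \<tau>0_def mult_left_le)
  have "(cmod p0)\<^sup>2 = s\<^sup>2 * (1 - b\<^sup>2) * b\<^sup>2"
  proof -
    have "(cmod a)\<^sup>2 = 1 - b\<^sup>2" using ab by simp
    then show ?thesis by (simp add: p0_def norm_mult power_mult_distrib)
  qed
  also have "\<dots> \<le> \<tau>0 * (1 - \<tau>0)"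
  proof -
    have "\<tau>0 * (1 - \<tau>0) - s\<^sup>2 * (1 - b\<^sup>2) * b\<^sup>2 = s * b\<^sup>2 * (1 - s)"
      by (simp add: \<tau>0_def power2_eq_square algebra_simps)
    also have "\<dots> \<ge> 0" using s b1 by simp
    finally show ?thesis by simp
  qed
  finally have p0: "(cmod p0)\<^sup>2 \<le> \<tau>0 * (1 - \<tau>0)" .
  have rhs: "of_real s * (of_real (b\<^sup>2) * \<alpha> + cnj a * b * P + a * b * Q) =
      of_real \<tau>0 * \<alpha> + p0 * P + cnj p0 * Q"
    by (simp add: \<tau>0_def p0_def algebra_simps)
  have lin: "linear (\<lambda>k. k * P + cnj k * Q)"
    by (intro linearI) (simp_all add: algebra_simps scaleR_conv_of_real)
  \<comment> \<open>The line is \<open>l\<close> \<mapsto> (\<open>\<tau>0 - l * \<mu>\<close>,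
    \<open>p0 + l * k\<close>); the equation for \<open>k\<close> makes the map constant on it. At
    \<open>l = \<Lambda>\<close> the line is on or outside the sphere while its first coordinate is
    still nonnegative.\<close>
  have "\<exists>\<mu> k \<Lambda>. 0 \<le> \<mu> \<and> 0 \<le> \<Lambda> \<and> \<Lambda> * \<mu> \<le> \<tau>0 \<and> k * P + cnj k * Q = of_real \<mu> * \<alpha> \<and>
      (\<tau>0 - \<Lambda> * \<mu>) * (1 - \<tau>0 + \<Lambda> * \<mu>) \<le> (cmod (p0 + of_real \<Lambda> * k))\<^sup>2"
  proof (cases "inj (\<lambda>k. k * P + cnj k * Q)")
    case True
    then have "surj (\<lambda>k. k * P + cnj k * Q)"
      using linear_injective_imp_surjective[OF lin] by simp
    then obtain k where "\<alpha> = k * P + cnj k * Q" by (rule surjE)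
    \<comment> \<open>Here \<mu> = 1, and at \<open>l = \<tau>0\<close> the first coordinate is 0,
      where the bound to be reached is 0.\<close>
    then show ?thesis
      using \<tau>0 by (intro exI[of _ 1] exI[of _ k] exI[of _ \<tau>0]) simp
  next
    case False
    then obtain k where k: "k \<noteq> 0" "k * P + cnj k * Q = 0"
      using linear_injective_0[OF lin] by auto
    \<comment> \<open>Moving along a kernel vector keeps the first coordinate fixed. This length
      forces the second one to have modulus at least 1.\<close>
    define \<Lambda> where "\<Lambda> = (1 + cmod p0) / cmod k"
    have "cmod (of_real \<Lambda> * k) = \<bar>\<Lambda>\<bar> * cmod k" by (simp add: norm_mult)
    also have "\<dots> = 1 + cmod p0" using k by (simp add: \<Lambda>_def)
    finally have "1 = cmod (of_real \<Lambda> * k) - cmod p0" by simp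
    also have "\<dots> \<le> cmod (p0 + of_real \<Lambda> * k)"
      by (metis add.commute norm_diff_ineq)
    finally have "1 \<le> (cmod (p0 + of_real \<Lambda> * k))\<^sup>2" by simp
    moreover have "\<tau>0 * (1 - \<tau>0) \<le> 1"
      using \<tau>0 s by (intro mult_le_one) auto
    ultimately show ?thesis
      using k \<tau>0 by (intro exI[of _ 0] exI[of _ k] exI[of _ \<Lambda>]) (auto simp: \<Lambda>_def)
  qed
  then obtain \<mu> k \<Lambda> where k: "0 \<le> \<mu>" "0 \<le> \<Lambda>" "\<Lambda> * \<mu> \<le> \<tau>0" "k * P + cnj k * Q = of_real \<mu> * \<alpha>"
    "(\<tau>0 - \<Lambda> * \<mu>) * (1 - \<tau>0 + \<Lambda> * \<mu>) \<le> (cmod (p0 + of_real \<Lambda> * k))\<^sup>2"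
    by blast
  define \<phi> where "\<phi> l = (cmod (p0 + of_real l * k))\<^sup>2 - (\<tau>0 - l * \<mu>) * (1 - \<tau>0 + l * \<mu>)" for l
  have "\<exists>l\<ge>0. l \<le> \<Lambda> \<and> \<phi> l = 0"
  proof (rule IVT')
    show "\<phi> 0 \<le> 0" "0 \<le> \<phi> \<Lambda>" "0 \<le> \<Lambda>" using p0 k by (auto simp: \<phi>_def)
    show "continuous_on {0..\<Lambda>} \<phi>" unfolding \<phi>_def by (intro continuous_intros)
  qed
  then obtain l where l: "0 \<le> l" "l \<le> \<Lambda>" "\<phi> l = 0" by blast
  show thesis
  proof (rule that[of "\<tau>0 - l * \<mu>" "p0 + of_real l * k"])
    have "l * \<mu> \<le> \<Lambda> * \<mu>" using l k by (intro mult_right_mono) auto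
    then show "0 \<le> \<tau>0 - l * \<mu>" using k by linarith
    show "\<tau>0 - l * \<mu> \<le> s" using \<tau>0 l k by (smt (verit) mult_nonneg_nonneg)
    show "(cmod (p0 + of_real l * k))\<^sup>2 = (\<tau>0 - l * \<mu>) * (1 - (\<tau>0 - l * \<mu>))"
      using l(3) by (simp add: \<phi>_def)
    have "of_real (\<tau>0 - l * \<mu>) * \<alpha> + (p0 + of_real l * k) * P + cnj (p0 + of_real l * k) * Q
      = of_real \<tau>0 * \<alpha> + p0 * P + cnj p0 * Q + of_real l * (k * P + cnj k * Q - of_real \<mu> * \<alpha>)"
      by (simp add: algebra_simps)
    then show "of_real (\<tau>0 - l * \<mu>) * \<alpha> + (p0 + of_real l * k) * P + cnj (p0 + of_real l * k) * Q
      = of_real s * (of_real (b\<^sup>2) * \<alpha> + cnj a * b * P + a * b * Q)"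
      unfolding rhs using k(4) by simp
  qed
qed

text \<open>Gram-Schmidt: \<open>v\<close> is the normalised component of \<open>y\<close>
  orthogonal to \<open>x\<close>. Dividing by its norm puts the phase into \<open>v\<close> and
  leaves \<open>b\<close> real.\<close>

lemma orthonormal_decomposition:
  assumes "x \<in> unit_sphere" "y \<in> unit_sphere" "y \<noteq> hinner x y *s x"
  obtains v b where "v \<in> unit_sphere" "hinner x v = 0" "y = hinner x y *s x + complex_of_real b *s v"
    "(cmod (hinner x y))\<^sup>2 + b\<^sup>2 = 1"
proof -
  define a where "a = hinner x y"
  define w where "w = y - a *s x"
  define b where "b = norm w"
  define v where "v = complex_of_real (1 / b) *s w"
  have b: "b > 0" using assms by (simp add: b_def w_def a_def)
  have y: "y = a *s x + w" by (simp add: w_def)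
  have xx: "hinner x x = 1" "hinner y y = 1" using assms by (auto simp: unit_sphere_def)
  have "a = hinner x y" by (fact a_def)
  also have "\<dots> = hinner x (a *s x + w)" by (simp only: y[symmetric])
  also have "\<dots> = a + hinner x w" by (simp add: hinner_add_right hinner_scale_right xx)
  finally have xw: "hinner x w = 0" by simp
  then have wx: "hinner w x = 0" using hinner_commute[of w x] by simp
  have ww: "hinner w w = complex_of_real (b\<^sup>2)" by (simp add: hinner_self b_def)
  have "1 = hinner (a *s x + w) (a *s x + w)" using xx by (simp only: y[symmetric])
  also have "\<dots> = cnj a * a + hinner w w"
    by (simp add: hinner_add_left hinner_add_right hinner_scale_left hinner_scale_right xx xw wx)
  also have "\<dots> = complex_of_real ((cmod a)\<^sup>2 + b\<^sup>2)"
    by (simp only: ww cnj_mult_self of_real_add)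
  finally have "(cmod a)\<^sup>2 + b\<^sup>2 = 1" by (metis of_real_eq_1_iff)
  moreover have "v \<in> unit_sphere"
    using b by (simp add: unit_sphere_def v_def hinner_scale_left hinner_scale_right ww power2_eq_square)
  moreover have "hinner x v = 0" by (simp add: v_def hinner_scale_right xw)
  moreover have "y = a *s x + complex_of_real b *s v"
    using b y by (simp add: v_def vector_smult_assoc flip: of_real_mult)
  ultimately show thesis using that unfolding a_def by blast
qed

text \<open>The distance bound does not depend on \<open>y\<close>; this is what makes the preimages uniformly close.\<close>

lemma fov_convex_combination_near:
  fixes A :: "complex ^ 'n ^ 'n"
  assumes x: "x \<in> unit_sphere" and y: "y \<in> unit_sphere" and s: "0 \<le> s" "s < 1"
  obtains u where "u \<in> unit_sphere" "(dist x u)\<^sup>2 \<le> 2 * s"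
    "hinner u (A *v u) = of_real (1 - s) * hinner x (A *v x) + of_real s * hinner y (A *v y)"
proof (cases "y = hinner x y *s x")
  case True
  define a where "a = hinner x y"
  have xx: "hinner x x = 1" "hinner y y = 1" using x y by (auto simp: unit_sphere_def)
  have ya: "y = a *s x" using True by (simp add: a_def)
  have "cnj a * a = 1" using xx by (simp add: ya hinner_scale_left hinner_scale_right mult.commute)
  then have "hinner y (A *v y) = hinner x (A *v x)"
    by (simp add: ya vector_scalar_commute hinner_scale)
  then show ?thesis using that[of x] x s by (simp add: algebra_simps)
next
  case False
  define a where "a = hinner x y"
  obtain v b where v: "v \<in> unit_sphere" "hinner x v = 0" "y = a *s x + complex_of_real b *s v"
    "(cmod a)\<^sup>2 + b\<^sup>2 = 1"
    using orthonormal_decomposition[OF x y False] unfolding a_def by blast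
  have vx: "hinner v x = 0" using v(2) hinner_commute[of v x] by simp
  have xx: "hinner x x = 1" "hinner v v = 1" using x v by (auto simp: unit_sphere_def)
  define \<alpha> where "\<alpha> = hinner v (A *v v) - hinner x (A *v x)"
  define P where "P = hinner x (A *v v)"
  define Q where "Q = hinner v (A *v x)"
  obtain \<tau> p where \<tau>: "0 \<le> \<tau>" "\<tau> \<le> s" "(cmod p)\<^sup>2 = \<tau> * (1 - \<tau>)"
    and val: "of_real \<tau> * \<alpha> + p * P + cnj p * Q = of_real s * (of_real (b\<^sup>2) * \<alpha> + cnj a * b * P + a * b * Q)"
    using bloch_sphere_point[OF v(4), of s \<alpha> P Q] s by (metis less_imp_le)
  \<comment> \<open>A unit vector with Bloch coordinates (\<tau>, \<open>p\<close>). Its phase is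
    fixed by a positive coefficient at \<open>x\<close>, possible since \<tau> \<le>
    \<open>s\<close> < 1.\<close>
  define c where "c = sqrt (1 - \<tau>)"
  define d where "d = p / of_real c"
  define u where "u = complex_of_real c *s x + d *s v"
  have c: "c > 0" "c\<^sup>2 = 1 - \<tau>" using \<tau> s by (auto simp: c_def)
  have p: "p = of_real c * d" using c by (simp add: d_def)
  have "(cmod d)\<^sup>2 = \<tau>" using \<tau>(3) c s \<tau> by (simp add: d_def norm_divide power_divide)
  then have dd: "cnj d * d = of_real \<tau>" by (simp only: cnj_mult_self)
  have cc: "complex_of_real c * of_real c = of_real (1 - \<tau>)"
    using c by (simp add: power2_eq_square flip: of_real_mult)
  have "(cmod a)\<^sup>2 = 1 - b\<^sup>2" using v(4) by simp
  then have aa: "cnj a * a = of_real (1 - b\<^sup>2)" by (simp only: cnj_mult_self)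
  show ?thesis
  proof (rule that[of u])
    have ortho: "hinner (e *s x + f *s v) (e *s x + f *s v) = cnj e * e + cnj f * f" for e f
      by (simp add: hinner_add_left hinner_add_right hinner_scale_left hinner_scale_right xx v(2) vx)
    have "hinner u u = of_real c * of_real c + cnj d * d"
      unfolding u_def ortho by simp
    then show "u \<in> unit_sphere" by (simp only: dd cc unit_sphere_def mem_Collect_eq) simp
    have "x - u = complex_of_real (1 - c) *s x + (- d) *s v"
      by (simp add: u_def vec_eq_iff algebra_simps)
    then have "hinner (x - u) (x - u) = of_real ((1 - c)\<^sup>2) + cnj d * d"
      by (simp only: ortho) (simp add: power2_eq_square)
    then have "complex_of_real ((dist x u)\<^sup>2) = of_real ((1 - c)\<^sup>2 + \<tau>)"
      by (simp add: hinner_self dd dist_norm)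
    then have "(dist x u)\<^sup>2 = (1 - c)\<^sup>2 + \<tau>" by (simp only: of_real_eq_iff)
    also have "\<dots> = 2 * (1 - c)" using c(2) by (simp add: power2_eq_square algebra_simps)
    \<comment> \<open>Since 0 < \<open>c\<close> \<le> 1, \<open>c\<^sup>2\<close> \<le>
      \<open>c\<close>; and 1 - \<open>c\<^sup>2\<close> = \<tau> \<le> \<open>s\<close>.\<close>
    also have "\<dots> \<le> 2 * (1 - c\<^sup>2)"
    proof -
      have "c \<le> 1" using \<tau> by (simp add: c_def)
      then have "c * c \<le> c * 1" using c by (intro mult_left_mono) auto
      then show ?thesis by (simp add: power2_eq_square)
    qed
    finally show "(dist x u)\<^sup>2 \<le> 2 * s" using c \<tau> by simp
    have "hinner u (A *v u) = of_real c * of_real c * hinner x (A *v x) + p * P + cnj p * Q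
        + cnj d * d * hinner v (A *v v)"
      by (simp add: u_def hinner_quadratic_form P_def Q_def p mult_ac)
    also have "\<dots> = hinner x (A *v x) + (of_real \<tau> * \<alpha> + p * P + cnj p * Q)"
      unfolding cc dd by (simp add: \<alpha>_def algebra_simps)
    also have "\<dots> = of_real (1 - s) * hinner x (A *v x) + of_real s *
       (of_real (1 - b\<^sup>2) * hinner x (A *v x) + cnj a * b * P + a * b * Q + of_real (b\<^sup>2) * hinner v (A *v v))"
      unfolding val by (simp add: \<alpha>_def algebra_simps)
    also have "\<dots> = of_real (1 - s) * hinner x (A *v x) + of_real s * hinner y (A *v y)"
      unfolding v(3) hinner_quadratic_form aa
      by (simp add: P_def Q_def power2_eq_square mult_ac)
    finally show "hinner u (A *v u) = of_real (1 - s) * hinner x (A *v x) + of_real s * hinner y (A *v y)" .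
  qed
qed

section \<open>The Toeplitz-Hausdorff theorem and compactness\<close>

lemma convex_field_of_values: "convex (field_of_values A)"
proof -
  have "(1 - s) *\<^sub>R z + s *\<^sub>R w \<in> field_of_values A"
    if zw: "z \<in> field_of_values A" "w \<in> field_of_values A" and s: "0 \<le> s" "s \<le> 1" for z w s
  proof (cases "s = 1")
    case False
    obtain x y where xy: "x \<in> unit_sphere" "y \<in> unit_sphere" "z = hinner x (A *v x)" "w = hinner y (A *v y)"
      using zw unfolding field_of_values_def by blast
    obtain u where "u \<in> unit_sphere"
      "hinner u (A *v u) = of_real (1 - s) * hinner x (A *v x) + of_real s * hinner y (A *v y)"
      using fov_convex_combination_near[OF xy(1,2), of s] False s by (metis order_le_less)
    then show ?thesis
      unfolding field_of_values_def xy(3,4) scaleR_conv_of_real by (metis (mono_tags, lifting) mem_Collect_eq)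
  qed (use zw in simp)
  then show ?thesis unfolding convex_alt by blast
qed

lemma compact_field_of_values: "compact (field_of_values A)"
proof -
  have "field_of_values A = (\<lambda>x. hinner x (A *v x)) ` unit_sphere"
    unfolding field_of_values_def by blast
  moreover have "continuous_on unit_sphere (\<lambda>x. hinner x (A *v x))"
    unfolding hinner_def matrix_vector_mult_def by (simp, intro continuous_intros)
  ultimately show ?thesis
    by (simp add: compact_continuous_image unit_sphere_eq_sphere)
qed

section \<open>Planar convex sets near a boundary point that is not round\<close>

text \<open>By compactness there is a last parameter up to 1/s at which the ray from
  \<open>z\<close> through \<open>z'\<close> is in \<open>F\<close>. Convexity prevents the ray from
  returning later.\<close>

lemma ray_exit_point:
  fixes F :: "'a :: real_normed_vector set"
  assumes F: "compact F" "convex F" and z: "z \<in> F" "z' \<in> F" "z' \<noteq> z"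
    and s: "0 < s" "s < 1" and out: "z + (1 / s) *\<^sub>R (z' - z) \<notin> F"
  obtains g where "g \<in> frontier F" "g \<noteq> z" "dist z g \<le> dist z z' / s"
    "\<forall>t>1. z + t *\<^sub>R (g - z) \<notin> F"
proof -
  define K where "K = {0..1/s} \<inter> (\<lambda>t. z + t *\<^sub>R (z' - z)) -` F"
  have "compact K"
    unfolding K_def using F(1)
    by (intro compact_continuous_image continuous_closed_preimage compact_Int_closed closed_vimage
        compact_imp_closed continuous_intros compact_Icc)
  moreover have "1 \<in> K" using s z by (simp add: K_def)
  ultimately obtain T where T: "T \<in> K" "\<And>t. t \<in> K \<Longrightarrow> t \<le> T"
    using compact_attains_sup[of K] by blast
  have T1: "1 \<le> T" "T \<le> 1 / s" using T(2)[OF \<open>1 \<in> K\<close>] T(1) by (auto simp: K_def)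
  define g where "g = z + T *\<^sub>R (z' - z)"
  have beyond: "z + t *\<^sub>R (g - z) \<notin> F" if "1 < t" for t
  proof
    assume *: "z + t *\<^sub>R (g - z) \<in> F"
    have tT: "T < t * T" using that T1 by simp
    show False
    proof (cases "t * T \<le> 1 / s")
      case True
      then have "t * T \<in> K" using * that T1 by (simp add: K_def g_def)
      then show False using T(2) tT by force
    next
      case False
      \<comment> \<open>A return beyond parameter 1/s is scaled back towards \<open>z\<close> to
        exactly 1/s, the point assumed outside \<open>F\<close>.\<close>
      define q where "q = 1 / (s * (t * T))"
      have q: "0 \<le> q" "q \<le> 1" "q * (t * T) = 1 / s"
        using False s that T1 by (auto simp: q_def field_simps)
      have "(1 - q) *\<^sub>R z + q *\<^sub>R (z + t *\<^sub>R (g - z)) \<in> F"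
        using convexD_alt[OF F(2) z(1) * q(1,2)] .
      also have "(1 - q) *\<^sub>R z + q *\<^sub>R (z + t *\<^sub>R (g - z)) = z + (q * (t * T)) *\<^sub>R (z' - z)"
        by (simp add: g_def algebra_simps)
      finally show False using out q by simp
    qed
  qed
  have gF: "g \<in> F" using T(1) by (simp add: K_def g_def)
  have gz: "g \<noteq> z" using T1 z by (simp add: g_def)
  have "g \<notin> interior F"
  proof
    assume "g \<in> interior F"
    then obtain e where e: "0 < e" "ball g e \<subseteq> F" by (auto simp: mem_interior)
    define \<eta> where "\<eta> = e / (2 * norm (g - z))"
    have \<eta>: "\<eta> > 0" using e gz by (simp add: \<eta>_def)
    have "dist g (z + (1 + \<eta>) *\<^sub>R (g - z)) = norm (\<eta> *\<^sub>R (g - z))"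
      unfolding dist_norm by (subst norm_minus_cancel[symmetric]) (simp add: algebra_simps)
    also have "\<dots> < e" using e gz by (simp add: \<eta>_def)
    finally show False using e beyond[of "1 + \<eta>"] \<eta> by (auto simp: subset_iff)
  qed
  then have "g \<in> frontier F" using gF closure_subset[of F] by (auto simp: frontier_def)
  moreover have "dist z g \<le> dist z z' / s"
  proof -
    have "dist z g = T * dist z z'" using T1 by (simp add: g_def dist_norm norm_minus_commute)
    also have "\<dots> \<le> 1 / s * dist z z'" using T1 by (intro mult_right_mono) auto
    finally show ?thesis by simp
  qed
  ultimately show thesis using that gz beyond by blast
qed

text \<open>If an arc of the boundary stopped at \<open>g\<close>, then projecting to \<open>F\<close> a segment that leaves \<open>F\<close> at
  \<open>g\<close> would prolong the arc, unless the projection is constant. Pushing out along all such segments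
  shows that the normal cone at \<open>g\<close> is a half-plane.\<close>

lemma boundary_segment_end:
  fixes F :: "complex set"
  assumes F: "compact F" "convex F" and g: "g \<in> frontier F" "g \<noteq> z" "dist z g < r"
    and beyond: "\<forall>t>1. z + t *\<^sub>R (g - z) \<notin> F"
    and comp: "connected_component_set (frontier F \<inter> cball z r - {z}) g \<subseteq> closed_segment z g"
  shows "F \<subseteq> {g + a *\<^sub>R (g - z) | a. a \<le> 0}"
proof -
  \<comment> \<open>Points closer than \<eta> to \<open>g\<close> lie in the ball around
    \<open>z\<close> and differ from \<open>z\<close>.\<close>
  define \<eta> where "\<eta> = min (r - dist z g) (dist z g)"
  have \<eta>: "\<eta> > 0" using g by (simp add: \<eta>_def)
  have "closed F" using F compact_imp_closed by blast
  then have gF: "g \<in> F" using g frontier_subset_eq by blast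
  with \<open>closed F\<close> have Fne: "F \<noteq> {}" "closed F" by auto
  \<comment> \<open>The projection of the segment from \<open>g\<close> to \<open>m\<close> is a
    connected part of the frontier through \<open>g\<close>, so by \<open>comp\<close> it lies
    between \<open>z\<close> and \<open>g\<close>. The obtuse-angle property then forces
    \<open>m\<close> to project to \<open>g\<close>, so \<open>m - g\<close> is normal to
    \<open>F\<close> at \<open>g\<close>.\<close>
  have push: "inner (m - g) (v - g) \<le> 0"
    if m: "dist g m < \<eta>" "0 \<le> inner (m - g) (g - z)" and v: "v \<in> F"
      and off: "\<And>q. q \<in> closed_segment g m \<Longrightarrow> q \<noteq> g \<Longrightarrow> q \<notin> F" for m v
  proof -
    let ?c = "closest_point F"
    let ?M = "?c ` closed_segment g m"
    have cg: "?c g = g" using gF by (rule closest_point_self)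
    have conn: "connected ?M"
      using F Fne by (intro connected_continuous_image continuous_on_closest_point) auto
    have gM: "g \<in> ?M" using cg by (metis ends_in_segment(1) imageI)
    have "?M \<subseteq> frontier F \<inter> cball z r - {z}"
    proof (rule image_subsetI)
      fix q assume q: "q \<in> closed_segment g m"
      have "dist (?c q) (?c g) \<le> dist q g"
        using F Fne by (intro closest_point_lipschitz) auto
      also have "\<dots> \<le> dist g m" using q segment_bound(1)[OF q] by (simp add: dist_norm norm_minus_commute)
      finally have d: "dist g (?c q) < \<eta>" using m cg by (simp add: dist_commute)
      then have "dist z (?c q) < r"
        using dist_triangle[of z "?c q" g] by (simp add: \<eta>_def)
      moreover have "?c q \<noteq> z"
        using d by (metis \<eta>_def dist_commute min_less_iff_conj order_less_irrefl)
      moreover have "?c q \<in> frontier F"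
      proof (cases "q = g")
        case True
        then show ?thesis using cg g(1) by simp
      next
        case False
        then have "q \<notin> F" using off q by blast
        \<comment> \<open>A point outside \<open>F\<close> cannot have its closest point in the
          interior.\<close>
        moreover have "q \<in> interior F" if c: "?c q \<in> interior F"
        proof -
          have "affine hull F = UNIV" using c affine_hull_nonempty_interior[of F] by blast
          moreover from this have "rel_interior F = interior F" by (rule rel_interior_interior)
          ultimately show ?thesis
            using c closest_point_in_rel_interior[OF Fne(2,1), of q] by simp
        qed
        ultimately have "?c q \<notin> interior F" using interior_subset[of F] by blast
        then show ?thesis
          using closest_point_in_set[OF Fne(2,1), of q] closure_subset[of F] by (auto simp: frontier_def)
      qed
      ultimately show "?c q \<in> frontier F \<inter> cball z r - {z}" by simp
    qed
    from connected_component_maximal[OF gM conn this] have "?M \<subseteq> closed_segment z g"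
      using comp by (rule subset_trans)
    then have "?c m \<in> closed_segment z g" by (simp add: image_subset_iff)
    then obtain u where u: "0 \<le> u" "u \<le> 1" "?c m = (1 - u) *\<^sub>R z + u *\<^sub>R g"
      by (auto simp: closed_segment_def)
    have eq: "g - ?c m = (1 - u) *\<^sub>R (g - z)" by (simp add: u(3) algebra_simps)
    have "inner (m - ?c m) (g - ?c m) \<le> 0"
      using F Fne gF by (intro closest_point_dot) auto
    moreover have "m - ?c m = (m - g) + (1 - u) *\<^sub>R (g - z)" by (simp flip: eq)
    ultimately have le: "(1 - u) * (inner (m - g) (g - z) + (1 - u) * inner (g - z) (g - z)) \<le> 0"
      by (simp only: eq inner_add_left inner_scaleR_left inner_scaleR_right)
    have "u = 1"
    proof (rule ccontr)
      assume "u \<noteq> 1"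
      then have "0 < 1 - u" "0 < inner (g - z) (g - z)" using u(2) g(2) by simp_all
      then have "0 < (1 - u) * (inner (m - g) (g - z) + (1 - u) * inner (g - z) (g - z))"
        using m(2) by (intro mult_pos_pos add_nonneg_pos)
      with le show False by linarith
    qed
    then have "?c m = g" using u by simp
    then show ?thesis using closest_point_dot[OF F(2) Fne(2) v, of m] by simp
  qed
  have half: "inner (g - z) (v - g) \<le> 0" if "v \<in> F" for v
  proof -
    define h where "h = \<eta> / (2 * norm (g - z))"
    have h: "h > 0" "h * norm (g - z) < \<eta>" using \<eta> g by (auto simp: h_def)
    have "inner (g + h *\<^sub>R (g - z) - g) (v - g) \<le> 0"
    proof (rule push[OF _ _ that])
      show "dist g (g + h *\<^sub>R (g - z)) < \<eta>" using h by (simp add: dist_norm)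
      show "0 \<le> inner (g + h *\<^sub>R (g - z) - g) (g - z)" using h by simp
      fix q assume q: "q \<in> closed_segment g (g + h *\<^sub>R (g - z))" "q \<noteq> g"
      then obtain u where u: "0 \<le> u" "q = (1 - u) *\<^sub>R g + u *\<^sub>R (g + h *\<^sub>R (g - z))"
        by (auto simp: closed_segment_def)
      then have q': "q = z + (1 + u * h) *\<^sub>R (g - z)" by (simp add: algebra_simps)
      then have "u \<noteq> 0" using q by auto
      then show "q \<notin> F" unfolding q' using u h by (intro beyond[rule_format]) simp
    qed
    then show ?thesis using h by (simp add: mult_le_0_iff)
  qed
  \<comment> \<open>By \<open>half\<close>, every direction \<open>e\<close> with positive component
    along \<open>g - z\<close> leaves \<open>F\<close> at once, so \<open>push\<close> applies to it
    too.\<close>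
  have half': "inner e (v - g) \<le> 0" if v: "v \<in> F" and e: "0 < inner e (g - z)" for v e
  proof -
    have e0: "e \<noteq> 0" using e by auto
    define h where "h = \<eta> / (2 * norm e)"
    have h: "h > 0" "h * norm e < \<eta>" using \<eta> e0 by (auto simp: h_def)
    have "inner (g + h *\<^sub>R e - g) (v - g) \<le> 0"
    proof (rule push[OF _ _ v])
      show "dist g (g + h *\<^sub>R e) < \<eta>" using h by (simp add: dist_norm)
      show "0 \<le> inner (g + h *\<^sub>R e - g) (g - z)" using h e by simp
      fix q assume q: "q \<in> closed_segment g (g + h *\<^sub>R e)" "q \<noteq> g"
      then obtain u where u: "0 \<le> u" "q = (1 - u) *\<^sub>R g + u *\<^sub>R (g + h *\<^sub>R e)"
        by (auto simp: closed_segment_def)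
      then have q': "q - g = (u * h) *\<^sub>R e" by (simp add: algebra_simps)
      then have "u \<noteq> 0" using q by auto
      then have "0 < inner (g - z) (q - g)" using u(1) h e unfolding q' by (simp add: inner_commute)
      then show "q \<notin> F" using half by force
    qed
    then show ?thesis using h by (simp add: mult_le_0_iff)
  qed
  show ?thesis
  proof
    fix v assume v: "v \<in> F"
    \<comment> \<open>Complex division makes \<open>g - z\<close> the unit of the real axis. The
      normals 1 + iL for all real L then confine \<open>w\<close> to the nonpositive reals.\<close>
    define w where "w = (v - g) / (g - z)"
    have vw: "v - g = w * (g - z)" using g by (simp add: w_def)
    have ip: "inner (p * (g - z)) (q * (g - z)) = inner p q * (norm (g - z))\<^sup>2" for p q :: complex
      by (simp add: inner_complex_def cmod_power2) (simp add: power2_eq_square algebra_simps)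
    have key: "Re w + L * Im w \<le> 0" for L
    proof -
      have "inner (Complex 1 L * (g - z)) (v - g) \<le> 0"
        using v g ip[of "Complex 1 L" 1] by (intro half') (auto simp: inner_complex_def)
      then show ?thesis
        unfolding vw ip using g by (simp add: mult_le_0_iff inner_complex_def)
    qed
    have "Im w = 0"
    proof (rule ccontr)
      assume "Im w \<noteq> 0"
      then show False using key[of "(1 - Re w) / Im w"] by simp
    qed
    moreover have "Re w \<le> 0" using key[of 0] by simp
    ultimately have "v = g + Re w *\<^sub>R (g - z)"
      using vw by (simp add: complex_eq_iff algebra_simps)
    then show "v \<in> {g + a *\<^sub>R (g - z) | a. a \<le> 0}" using \<open>Re w \<le> 0\<close> by blast
  qed
qed

text \<open>The component of \<open>g\<close> together with \<open>z\<close> is a segment from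
  \<open>z\<close> to some \<open>p\<close> in \<open>F\<close>. As the ray through \<open>g\<close>
  leaves \<open>F\<close> at \<open>g\<close>, \<open>p\<close> = \<open>g\<close>, so the arc stops
  there and \<open>boundary_segment_end\<close> applies.\<close>

lemma nonround_boundary_exit:
  fixes F :: "complex set"
  assumes F: "compact F" "convex F" and z: "z \<in> frontier F" "\<not> round_point (frontier F) z"
  obtains r where "0 < r"
    "\<forall>g\<in>frontier F. g \<noteq> z \<longrightarrow> dist z g < r \<longrightarrow> (\<forall>t>1. z + t *\<^sub>R (g - z) \<notin> F)
       \<longrightarrow> F \<subseteq> {g + a *\<^sub>R (g - z) | a. a \<le> 0}"
proof -
  obtain r0 where r0: "r0 > 0" "\<And>r N. 0 < r \<Longrightarrow> r < r0 \<Longrightarrow> N \<in> one_sided_nbhds (frontier F) z r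
      \<Longrightarrow> \<exists>p. N = closed_segment z p"
    using z unfolding round_point_def by blast
  define r where "r = r0 / 2"
  have r: "0 < r" "r < r0" using r0 by (auto simp: r_def)
  have FF: "frontier F \<subseteq> F" using F compact_imp_closed frontier_subset_eq by blast
  show thesis
  proof (rule that[OF r(1)], intro ballI impI)
    fix g assume g: "g \<in> frontier F" "g \<noteq> z" "dist z g < r"
      and beyond: "\<forall>t>1. z + t *\<^sub>R (g - z) \<notin> F"
    let ?C = "connected_component_set (frontier F \<inter> cball z r - {z}) g"
    have gin: "g \<in> frontier F \<inter> cball z r - {z}" using g by simp
    have "insert z ?C \<in> one_sided_nbhds (frontier F) z r"
      unfolding one_sided_nbhds_def using componentsI[OF gin] by blast
    then obtain p where p: "insert z ?C = closed_segment z p" using r0 r by blast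
    have "g \<in> ?C" using gin by simp
    then have "g \<in> closed_segment z p" using p by blast
    then obtain u where u: "0 \<le> u" "u \<le> 1" "g = (1 - u) *\<^sub>R z + u *\<^sub>R p"
      by (auto simp: closed_segment_def)
    have u0: "u \<noteq> 0" using u g by auto
    have "?C \<subseteq> F" using connected_component_subset[of "frontier F \<inter> cball z r - {z}" g] FF by blast
    moreover have "z \<in> F" using z FF by blast
    ultimately have "p \<in> F" using p by (metis ends_in_segment(2) insert_subset subsetD)
    have pg: "p = z + (1 / u) *\<^sub>R (g - z)"
    proof -
      have "g - z = u *\<^sub>R (p - z)" using u by (simp add: algebra_simps)
      then show ?thesis using u0 by simp
    qed
    have "u = 1"
    proof (rule ccontr)
      assume "u \<noteq> 1"
      then have "1 < 1 / u" using u u0 by simp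
      then show False using beyond \<open>p \<in> F\<close> unfolding pg by blast
    qed
    then have "p = g" using pg by simp
    then have "?C \<subseteq> closed_segment z g" using p by blast
    then show "F \<subseteq> {g + a *\<^sub>R (g - z) | a. a \<le> 0}"
      by (rule boundary_segment_end[OF F g beyond])
  qed
qed

text \<open>If the conclusion fails at a boundary point \<open>z\<close>, then rays from \<open>z\<close> leave \<open>F\<close> at points
  arbitrarily close to \<open>z\<close>. Each of these would be an endpoint of \<open>F\<close>, a segment, but three points
  cannot all be endpoints.\<close>

lemma nonround_locally_conic:
  fixes F :: "complex set"
  assumes F: "compact F" "convex F" and z: "z \<in> F" "\<not> round_point (frontier F) z"
    and s: "0 < s" "s < 1"
  obtains \<delta> where "0 < \<delta>" "\<And>z'. z' \<in> F \<Longrightarrow> dist z z' < \<delta> \<Longrightarrow> z + (1 / s) *\<^sub>R (z' - z) \<in> F"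
proof (cases "z \<in> interior F")
  case True
  then obtain e where e: "0 < e" "ball z e \<subseteq> F" by (auto simp: mem_interior)
  show thesis
  proof (rule that[of "s * e"])
    show "0 < s * e" using e s by simp
    fix z' assume "dist z z' < s * e"
    then have "dist z (z + (1 / s) *\<^sub>R (z' - z)) < e"
      using s by (simp add: dist_norm norm_minus_commute divide_less_eq mult.commute)
    then show "z + (1 / s) *\<^sub>R (z' - z) \<in> F" using e by (auto simp: subset_iff)
  qed
next
  case False
  then have zf: "z \<in> frontier F" using z closure_subset[of F] by (auto simp: frontier_def)
  have FF: "frontier F \<subseteq> F" using F compact_imp_closed frontier_subset_eq by blast
  obtain r where r: "0 < r"
    "\<forall>g\<in>frontier F. g \<noteq> z \<longrightarrow> dist z g < r \<longrightarrow> (\<forall>t>1. z + t *\<^sub>R (g - z) \<notin> F)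
       \<longrightarrow> F \<subseteq> {g + a *\<^sub>R (g - z) | a. a \<le> 0}"
    by (rule nonround_boundary_exit[OF F zf z(2)])
  have "\<exists>\<delta>>0. \<forall>z'\<in>F. dist z z' < \<delta> \<longrightarrow> z + (1 / s) *\<^sub>R (z' - z) \<in> F"
  proof (rule ccontr)
    assume bad: "\<not> ?thesis"
    define E where "E = {g \<in> F. g \<noteq> z \<and> F \<subseteq> {g + a *\<^sub>R (g - z) | a. a \<le> 0}}"
    have ED: "g \<in> F" "g \<noteq> z" "F \<subseteq> {g + a *\<^sub>R (g - z) | a. a \<le> 0}" if "g \<in> E" for g
      using that by (simp_all add: E_def)
    have ex: "\<exists>g\<in>E. dist z g < d" if "d > 0" for d
    proof -
      \<comment> \<open>The factor \<open>s\<close> cancels the 1/s in the distance bound of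
        \<open>ray_exit_point\<close>.\<close>
      have "s * min d r > 0" using that r s by simp
      then obtain z' where z': "z' \<in> F" "dist z z' < s * min d r" "z + (1 / s) *\<^sub>R (z' - z) \<notin> F"
        using bad by blast
      then have neq: "z' \<noteq> z" using z by auto
      obtain g where g: "g \<in> frontier F" "g \<noteq> z" "dist z g \<le> dist z z' / s"
        "\<forall>t>1. z + t *\<^sub>R (g - z) \<notin> F"
        by (rule ray_exit_point[OF F z(1) z'(1) neq s z'(3)])
      have "dist z z' / s < min d r" by (metis z'(2) s(1) mult.commute pos_divide_less_eq)
      then have "dist z g < d" "dist z g < r" using g(3) by auto
      from r(2)[rule_format, OF g(1,2) this(2)] g(4) have "g \<in> E"
        unfolding E_def using subsetD[OF FF g(1)] g(2) by blast
      then show ?thesis using \<open>dist z g < d\<close> by blast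
    qed
    \<comment> \<open>Each endpoint lies on the ray from the other through \<open>z\<close>, so the
      two scaling factors are at most 1 and mutually inverse. Unequal distances give one of them
      modulus above 1, so both are negative: the endpoints are on opposite sides of
      \<open>z\<close>.\<close>
    have opp: "\<exists>a<0. g' - z = a *\<^sub>R (g - z)"
      if gg: "g \<in> E" "g' \<in> E" "dist z g' < dist z g" for g g'
    proof -
      obtain a where a: "a \<le> 0" "g' = g + a *\<^sub>R (g - z)"
        using subsetD[OF ED(3)[OF gg(1)] ED(1)[OF gg(2)]] by blast
      obtain b where b: "b \<le> 0" "g = g' + b *\<^sub>R (g' - z)"
        using subsetD[OF ED(3)[OF gg(2)] ED(1)[OF gg(1)]] by blast
      have g0: "g \<noteq> z" using gg(1) by (rule ED)
      have A: "g' - z = (1 + a) *\<^sub>R (g - z)" using a by (simp add: algebra_simps)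
      have B: "g - z = (1 + b) *\<^sub>R (g' - z)" using b by (simp add: algebra_simps)
      have "norm (g - z) = \<bar>1 + b\<bar> * norm (g' - z)" by (subst B) simp
      moreover have "norm (g' - z) < norm (g - z)" using gg(3) by (simp add: dist_norm norm_minus_commute)
      ultimately have "1 < \<bar>1 + b\<bar>"
        using mult_right_mono[of "\<bar>1 + b\<bar>" 1 "norm (g' - z)"] by force
      then have b1: "1 + b < 0" using b by linarith
      have "g - z = (1 + b) *\<^sub>R ((1 + a) *\<^sub>R (g - z))" using B unfolding A .
      then have "g - z = ((1 + b) * (1 + a)) *\<^sub>R (g - z)" by (simp only: scaleR_scaleR)
      then have "(1 + b) * (1 + a) = 1" using g0
        by (metis eq_iff_diff_eq_0 scaleR_cancel_right scaleR_one)
      then have "1 + a < 0" using b1 by (smt (verit) mult_nonpos_nonneg)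
      then show ?thesis using A by blast
    qed
    obtain g1 where g1: "g1 \<in> E" using ex[of 1] by auto
    then have "0 < dist z g1" using ED(2)[OF g1] by simp
    then obtain g2 where g2: "g2 \<in> E" "dist z g2 < dist z g1" using ex by blast
    then have "0 < dist z g2" using ED(2)[OF g2(1)] by simp
    then obtain g3 where g3: "g3 \<in> E" "dist z g3 < dist z g2" using ex by blast
    obtain a where a: "a < 0" "g2 - z = a *\<^sub>R (g1 - z)" using opp[OF g1 g2] by blast
    obtain b where b: "b < 0" "g3 - z = b *\<^sub>R (g2 - z)" using opp[OF g2(1) g3] by blast
    obtain c where c: "c < 0" "g3 - z = c *\<^sub>R (g1 - z)" using opp[OF g1 g3(1) less_trans[OF g3(2) g2(2)]] by blast
    \<comment> \<open>Three points cannot be pairwise on opposite sides: \<open>c\<close> would be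
      the product of two negative numbers.\<close>
    have "(b * a) *\<^sub>R (g1 - z) = c *\<^sub>R (g1 - z)" using b(2)[unfolded a(2)] c(2) by (simp only: scaleR_scaleR)
    then have "b * a = c" using ED(2)[OF g1] by simp
    then show False using mult_neg_neg[OF b(1) a(1)] c(1) by simp
  qed
  then show thesis using that by blast
qed

section \<open>Passage to projective space and strong continuity\<close>

lemma quotient_metric_continuous:
  assumes "quotient_metric \<rho>" "x \<in> unit_sphere" "0 < \<epsilon>"
  obtains \<eta> where "0 < \<eta>" "\<And>u. u \<in> unit_sphere \<Longrightarrow> dist x u < \<eta> \<Longrightarrow> \<rho> (cproj x) (cproj u) < \<epsilon>"
proof -
  interpret M: Metric_space cproj_space \<rho> using assms by (simp add: quotient_metric_def)
  have "continuous_map (top_of_set unit_sphere) M.mtopology cproj"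
    using assms by (simp add: quotient_metric_def quotient_imp_continuous_map)
  then obtain U where U: "openin (top_of_set unit_sphere) U" "x \<in> U"
    "\<And>y. y \<in> U \<Longrightarrow> cproj y \<in> M.mball (cproj x) \<epsilon>"
    using assms unfolding M.continuous_map_to_metric by (metis topspace_euclidean_subtopology)
  then obtain \<eta> where "0 < \<eta>" "ball x \<eta> \<inter> unit_sphere \<subseteq> U"
    by (meson openin_contains_ball)
  then show thesis using that U(3) by (auto simp: subset_iff)
qed

theorem theorem4:
  fixes A :: "complex ^ 'n ^ 'n"
    and \<rho> :: "(complex ^ 'n) set \<Rightarrow> (complex ^ 'n) set \<Rightarrow> real"
    and z :: complex
  assumes "quotient_metric \<rho>"
    and "z \<in> field_of_values A"
    and "\<not> round_point (frontier (field_of_values A)) z"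
  shows "strongly_continuous_at (field_of_values A) dist \<rho> (fov_inverse A) z"
  unfolding strongly_continuous_at_def
proof (intro ballI allI impI)
  fix p :: "(complex ^ 'n) set" and \<epsilon> :: real
  assume p: "p \<in> fov_inverse A z" and \<epsilon>: "0 < \<epsilon>"
  obtain x where x: "x \<in> unit_sphere" "p = cproj x"
    using p by (auto simp: fov_inverse_def cproj_space_def quotient_def cproj_def)
  have fx: "hinner x (A *v x) = z" using p x fov_map_cproj[OF x(1), of A] by (simp add: fov_inverse_def)
  obtain \<eta> where \<eta>: "0 < \<eta>" "\<And>u. u \<in> unit_sphere \<Longrightarrow> dist x u < \<eta> \<Longrightarrow> \<rho> (cproj x) (cproj u) < \<epsilon>"
    using quotient_metric_continuous[OF assms(1) x(1) \<epsilon>] by blast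
  \<comment> \<open>Small enough that \<surd>(2 s) < \<eta>, and below 1.\<close>
  define s where "s = min (1 / 2) (\<eta>\<^sup>2 / 4)"
  have s: "0 < s" "s < 1" "2 * s < \<eta>\<^sup>2" using \<eta> by (auto simp: s_def min_def)
  obtain \<delta> where \<delta>: "0 < \<delta>" "\<And>z'. z' \<in> field_of_values A \<Longrightarrow> dist z z' < \<delta>
      \<Longrightarrow> z + (1 / s) *\<^sub>R (z' - z) \<in> field_of_values A"
    using nonround_locally_conic[OF compact_field_of_values convex_field_of_values assms(2,3) s(1,2)]
    by blast
  show "\<exists>\<delta>>0. \<forall>z'\<in>field_of_values A. dist z z' < \<delta> \<longrightarrow> (\<exists>q\<in>fov_inverse A z'. \<rho> p q < \<epsilon>)"
  proof (intro exI[of _ \<delta>] conjI ballI impI \<delta>(1))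
    fix z' assume z': "z' \<in> field_of_values A" "dist z z' < \<delta>"
    \<comment> \<open>Dilating \<open>z'\<close> from \<open>z\<close> by 1/s stays in the field of
      values, so \<open>z'\<close> is the combination of \<open>z\<close> and the value at
      \<open>y\<close> with weight \<open>s\<close> at \<open>y\<close>.\<close>
    obtain y where y: "y \<in> unit_sphere" "z + (1 / s) *\<^sub>R (z' - z) = hinner y (A *v y)"
      using \<delta>(2)[OF z'] unfolding field_of_values_def by blast
    obtain u where u: "u \<in> unit_sphere" "(dist x u)\<^sup>2 \<le> 2 * s"
      "hinner u (A *v u) = of_real (1 - s) * hinner x (A *v x) + of_real s * hinner y (A *v y)"
      using fov_convex_combination_near[OF x(1) y(1), of s A] s by (metis less_imp_le)
    have "hinner u (A *v u) = z'"
      unfolding u(3) fx y(2)[symmetric] using s by (simp add: scaleR_conv_of_real field_simps)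
    moreover have "cproj u \<in> cproj_space"
      using u(1) unfolding cproj_space_def cproj_def by (rule quotientI)
    ultimately have "cproj u \<in> fov_inverse A z'"
      using fov_map_cproj[OF u(1), of A] by (simp add: fov_inverse_def)
    moreover have "(dist x u)\<^sup>2 < \<eta>\<^sup>2" using u(2) s by linarith
    then have "dist x u < \<eta>" using \<eta>(1) by (simp add: power2_less_imp_less)
    then have "\<rho> p (cproj u) < \<epsilon>" using \<eta>(2) u(1) x(2) by blast
    ultimately show "\<exists>q\<in>fov_inverse A z'. \<rho> p q < \<epsilon>" by blast
  qed
qed

end
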